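(* Fix $\tau>0$ and gains $K_p>0$, $K_i>0$, $K_d=\frac1\tau$. Consider the closed-loop platoon described in the context, and suppose the leader moves at constant speed $v_0(t)\equiv v^\star$ for $t\ge t_0$. Assume time-scale separation $\varepsilon:=\omega_n\tau_a\ll 1$ so that $a_i(t)=u_i(t)+\mathcal{O}(\varepsilon)$ uniformly. Then, for each follower $i\ge 1$ the trajectories satisfy $$e_i(t)\to 0,\qquad \Delta v_i(t)\to 0\qquad (t\to\infty),$$ hence $$(s_i(t),v_i(t))\to(\eta+\tau v^\star,\;v^\star)\qquad (t\to\infty).$$ In particular, the closed-loop platoon converges to the OVRV constant-time-gap equilibrium.
   Context: Platoon model. Vehicle $0$ is the leader; vehicles $i\ge 1$ are followers, vehicle $i$ following vehicle $i-1$. Vehicle $i$ has position $p_i$, speed $v_i$ and realized acceleration $a_i$. The spacing is $s_i=p_{i-1}-p_i-L$ with $L$ the effective vehicle length, and the relative speed is $\Delta v_i=v_{i-1}-v_i$. With commanded acceleration $u_i$ and actuation time constant $\tau_a>0$, each follower obeys $$\dot s_i=v_{i-1}-v_i,\qquad \dot v_i=a_i,\qquad \dot a_i=-\frac{1}{\tau_a}(a_i-u_i).$$ With desired time gap $\tau>0$ and standstill offset $\eta$, the constant-time-gap spacing error is $e_i=s_i-\eta-\tau v_i$. Let $z_i=\int e_i\,dt$, so $\dot z_i=e_i$. The safety (control barrier function) filter is assumed inactive, so the command is given by the PID law $$u_i=K_p e_i+K_i z_i+K_d(v_{i-1}-v_i).$$ The natural frequency $\omega_n>0$ of the spacing-error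 loop is defined by $\omega_n^2=\tau K_i$. The Optimal Velocity with Relative Velocity (OVRV) car-following model is $a_i=k_1[s_i-\eta-\tau v_i]+k_2(v_{i-1}-v_i)$; its constant-time-gap equilibrium at speed $v^\star$ is $s_i=\eta+\tau v^\star$, $v_i=v^\star$ for all followers. *)

theory Defs
  imports "HOL-Analysis.Analysis" "HOL-Library.Extended_Nat"
begin

text \<open>Trajectories are families \<open>p i t\<close>, \<open>v i t\<close>, \<open>a i t\<close>, \<open>z i t\<close>, indexed by the vehicle \<open>i\<close> and the
  time \<open>t\<close>; vehicle \<open>0\<close> is the leader. A platoon has followers \<open>1, ..., N\<close>, where \<open>N = \<infinity>\<close> stands for
  infinitely many followers.\<close>

definition followers :: "enat \<Rightarrow> nat set" where
  "followers N = {i. 1 \<le> i \<and> enat i \<le> N}"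

definition spacing :: "real \<Rightarrow> (nat \<Rightarrow> real \<Rightarrow> real) \<Rightarrow> nat \<Rightarrow> real \<Rightarrow> real" where
  "spacing L p i t = p (i - 1) t - p i t - L"

definition rel_speed :: "(nat \<Rightarrow> real \<Rightarrow> real) \<Rightarrow> nat \<Rightarrow> real \<Rightarrow> real" where
  "rel_speed v i t = v (i - 1) t - v i t"

definition spacing_error ::
  "real \<Rightarrow> real \<Rightarrow> real \<Rightarrow> (nat \<Rightarrow> real \<Rightarrow> real) \<Rightarrow> (nat \<Rightarrow> real \<Rightarrow> real) \<Rightarrow> nat \<Rightarrow> real \<Rightarrow> real" where
  "spacing_error \<tau> \<eta> L p v i t = spacing L p i t - \<eta> - \<tau> * v i t"

definition pid_command ::
  "real \<Rightarrow> real \<Rightarrow> real \<Rightarrow> real \<Rightarrow> real \<Rightarrow> real \<Rightarrow>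
   (nat \<Rightarrow> real \<Rightarrow> real) \<Rightarrow> (nat \<Rightarrow> real \<Rightarrow> real) \<Rightarrow> (nat \<Rightarrow> real \<Rightarrow> real) \<Rightarrow> nat \<Rightarrow> real \<Rightarrow> real" where
  "pid_command Kp Ki Kd \<tau> \<eta> L p v z i t =
     Kp * spacing_error \<tau> \<eta> L p v i t + Ki * z i t + Kd * rel_speed v i t"

text \<open>The equations are required on \<open>[t0, \<infinity>)\<close> only (one-sided derivatives at \<open>t0\<close>). The safety filter
  is inactive, so the actuator is driven directly by the PID command. The integral state \<open>z i\<close> is an
  arbitrary antiderivative of the spacing error, i.e. its initial value is free.\<close>

definition closed_loop_platoon ::
  "real \<Rightarrow> real \<Rightarrow> real \<Rightarrow> real \<Rightarrow> real \<Rightarrow> real \<Rightarrow> real \<Rightarrow> enat \<Rightarrow> real \<Rightarrow>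
   (nat \<Rightarrow> real \<Rightarrow> real) \<Rightarrow> (nat \<Rightarrow> real \<Rightarrow> real) \<Rightarrow> (nat \<Rightarrow> real \<Rightarrow> real) \<Rightarrow> (nat \<Rightarrow> real \<Rightarrow> real) \<Rightarrow> bool"
  where
  "closed_loop_platoon Kp Ki Kd \<tau> \<tau>a \<eta> L N t0 p v a z \<longleftrightarrow>
     (\<forall>i\<in>followers N. \<forall>t\<ge>t0.
        (spacing L p i has_real_derivative v (i - 1) t - v i t) (at t within {t0..}) \<and>
        (v i has_real_derivative a i t) (at t within {t0..}) \<and>
        (a i has_real_derivative - (1 / \<tau>a) * (a i t - pid_command Kp Ki Kd \<tau> \<eta> L p v z i t))
          (at t within {t0..}) \<and>
        (z i has_real_derivative spacing_error \<tau> \<eta> L p v i t) (at t within {t0..}))"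

definition ovrv_acceleration ::
  "real \<Rightarrow> real \<Rightarrow> real \<Rightarrow> real \<Rightarrow> real \<Rightarrow> real \<Rightarrow> real \<Rightarrow> real" where
  "ovrv_acceleration k1 k2 \<tau> \<eta> s v_pred v = k1 * (s - \<eta> - \<tau> * v) + k2 * (v_pred - v)"

text \<open>\<open>S i\<close> and \<open>V i\<close> are constant spacings and speeds. The first two conjuncts for each follower say
  that \<open>(S, V)\<close> is a rest point of the OVRV platoon (zero rate of change of every spacing and speed),
  the last two that it is the constant-time-gap one; for degenerate gains such as \<open>k1 = 0\<close> there are
  other rest points.\<close>

definition ovrv_ctg_equilibrium ::
  "real \<Rightarrow> real \<Rightarrow> real \<Rightarrow> real \<Rightarrow> enat \<Rightarrow> real \<Rightarrow> (nat \<Rightarrow> real) \<Rightarrow> (nat \<Rightarrow> real) \<Rightarrow> bool" where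
  "ovrv_ctg_equilibrium k1 k2 \<tau> \<eta> N vstar S V \<longleftrightarrow>
     V 0 = vstar \<and>
     (\<forall>i\<in>followers N.
        V (i - 1) - V i = 0 \<and>
        ovrv_acceleration k1 k2 \<tau> \<eta> (S i) (V (i - 1)) (V i) = 0 \<and>
        S i = \<eta> + \<tau> * vstar \<and> V i = vstar)"

end

theory Submission
  imports Defs
begin

text \<open>
  Take one follower and write \<open>w\<close> for the speed of its predecessor, \<open>b = w'\<close> for the acceleration
  of the predecessor, and \<open>d = a - u\<close> for the actuation defect. The gain \<open>Kd = 1 / \<tau>\<close> is the one for
  which the damping term cancels the relative speed in \<open>e' = (w - v) - \<tau> a\<close>, so that the error
  loop closes up to the defect: \<open>z' = e\<close> and \<open>e' = - \<tau> Kp e - \<tau> Ki z - \<tau> d\<close>. For \<open>d = 0\<close> this is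
  a damped oscillator with natural frequency \<open>\<omega>n\<close>. The third coordinate is
  \<open>y = (w - v) - e / \<tau>\<close>. It satisfies \<open>y' = b - (w - v) / \<tau>\<close>, because the acceleration \<open>a\<close> drops
  out, and hence it is an exponentially stable filter driven by \<open>e\<close> and \<open>b\<close>. Finally
  \<open>d' = - d / \<tau>a - u'\<close>, where \<open>u'\<close> is a fixed linear form in \<open>e\<close>, \<open>z\<close>, \<open>y\<close>, \<open>d\<close>, \<open>b\<close>
  whose coefficients do not involve \<open>\<tau>a\<close>.

  A quadratic energy that combines strict Lyapunov functions for these three pieces therefore decays
  as \<open>V' \<le> - c V + K b\<^sup>2\<close> as soon as \<open>2 / \<tau>a\<close> dominates all couplings of \<open>d\<close> with the slow
  variables (\<open>follower_energy_dissipation\<close>). The threshold for \<open>\<tau>a\<close> depends on the gains and on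
  \<open>\<tau>\<close> only, so one and the same threshold serves every follower, and it stays uniform for an infinite
  platoon.

  If \<open>b\<close> tends to \<open>0\<close>, the inequality forces \<open>V\<close> to \<open>0\<close> (\<open>dissipation_tendsto_0\<close>), hence also \<open>e\<close>,
  \<open>w - v\<close> and the follower's own acceleration \<open>a\<close> (\<open>follower_converges\<close>). This \<open>a\<close> is the input
  \<open>b\<close> of the next vehicle, and the leader has \<open>b = 0\<close>, so convergence travels down the platoon
  by induction on the vehicle index.
\<close>

section \<open>Decay from a dissipation inequality\<close>

text \<open>Gronwall's argument: the dissipation inequality says that \<open>exp (c t) (V - r)\<close> decreases.\<close>

lemma dissipation_upper_bound:
  fixes V V' :: "real \<Rightarrow> real"
  assumes deriv: "\<And>t. t \<ge> T \<Longrightarrow> (V has_real_derivative V' t) (at t within {T..})"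
    and dissip: "\<And>t. t \<ge> T \<Longrightarrow> V' t \<le> c * (r - V t)"
    and "t \<ge> T"
  shows "V t \<le> r + exp (c * (T - t)) * (V T - r)"
proof -
  let ?h = "\<lambda>t. exp (c * t) * (V t - r)"
  have h_deriv: "(?h has_real_derivative exp (c * x) * (V' x - c * (r - V x))) (at x within {T..})"
    if "x \<ge> T" for x
    by (rule derivative_eq_intros deriv[OF that] refl | simp add: algebra_simps)+
  have "?h t \<le> ?h T"
  proof (rule DERIV_nonpos_imp_decreasing_open[OF \<open>t \<ge> T\<close>])
    fix x assume "T < x" "x < t"
    then have "(?h has_real_derivative exp (c * x) * (V' x - c * (r - V x))) (at x)"
      using h_deriv[of x] at_within_interior[of x "{T..}"] by simp
    moreover have "exp (c * x) * (V' x - c * (r - V x)) \<le> 0"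
      using dissip[of x] \<open>T < x\<close> by (intro mult_nonneg_nonpos) auto
    ultimately show "\<exists>y. (?h has_real_derivative y) (at x) \<and> y \<le> 0" by blast
  next
    show "continuous_on {T..t} ?h"
      by (rule continuous_on_subset[of "{T..}"], rule DERIV_continuous_on, rule h_deriv) auto
  qed
  then have "exp (- (c * t)) * ?h t \<le> exp (- (c * t)) * ?h T" by simp
  moreover have "exp (- (c * t)) * ?h t = V t - r"
    by (simp add: exp_minus)
  moreover have "exp (- (c * t)) * ?h T = exp (c * (T - t)) * (V T - r)"
    by (simp add: exp_minus exp_diff right_diff_distrib divide_inverse)
  ultimately show ?thesis by linarith
qed

text \<open>After some time the input \<open>g\<close> is below \<open>c r\<close>, and from then on \<open>V\<close> relaxes exponentially to
  at most \<open>r\<close>; here \<open>r\<close> is arbitrary.\<close>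

lemma dissipation_tendsto_0:
  fixes V V' g :: "real \<Rightarrow> real"
  assumes deriv: "\<And>t. t \<ge> t0 \<Longrightarrow> (V has_real_derivative V' t) (at t within {t0..})"
    and dissip: "\<And>t. t \<ge> t0 \<Longrightarrow> V' t \<le> - c * V t + g t"
    and "c > 0" and g: "(g \<longlongrightarrow> 0) at_top"
    and nonneg: "\<And>t. V t \<ge> 0"
  shows "(V \<longlongrightarrow> 0) at_top"
proof (rule tendstoI)
  fix \<epsilon> :: real assume "\<epsilon> > 0"
  define r where "r = \<epsilon> / 2"
  have "r > 0" using \<open>\<epsilon> > 0\<close> by (simp add: r_def)
  have "eventually (\<lambda>t. g t < c * r) at_top"
    using order_tendstoD(2)[OF g] \<open>c > 0\<close> \<open>r > 0\<close> by simp
  then obtain T1 where T1: "\<And>t. t \<ge> T1 \<Longrightarrow> g t < c * r"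
    by (auto simp: eventually_at_top_linorder)
  define T where "T = max t0 T1"
  have bound: "V t \<le> r + exp (c * (T - t)) * (V T - r)" if "t \<ge> T" for t
  proof (rule dissipation_upper_bound[of T V V', OF _ _ that])
    fix x assume "x \<ge> T"
    then show "(V has_real_derivative V' x) (at x within {T..})"
      by (intro DERIV_subset[OF deriv]) (auto simp: T_def)
    show "V' x \<le> c * (r - V x)"
      using dissip[of x] T1[of x] \<open>x \<ge> T\<close> by (simp add: T_def algebra_simps)
  qed
  have "((\<lambda>t. exp (c * (T - t)) * (V T - r)) \<longlongrightarrow> 0) at_top"
  proof -
    have "filterlim (\<lambda>t. c * (T - t)) at_bot at_top"
      unfolding filterlim_at_bot eventually_at_top_linorder
    proof (intro allI)
      fix Z
      show "\<exists>N. \<forall>t\<ge>N. c * (T - t) \<le> Z"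
        using \<open>c > 0\<close> by (intro exI[of _ "T - Z / c"]) (auto simp: field_simps)
    qed
    then show ?thesis
      by (intro tendsto_mult_left_zero filterlim_compose[OF exp_at_bot])
  qed
  then have "eventually (\<lambda>t. exp (c * (T - t)) * (V T - r) < r) at_top"
    using \<open>r > 0\<close> by (rule order_tendstoD(2))
  then show "eventually (\<lambda>t. dist (V t) 0 < \<epsilon>) at_top"
    using eventually_ge_at_top[of T]
  proof eventually_elim
    case (elim t)
    then show ?case using bound[of t] nonneg[of t] by (simp add: r_def)
  qed
qed

section \<open>Algebra of the composite energy\<close>

lemma young_ineq:
  fixes k x d m :: real
  assumes "m > 0"
  shows "k * x * d \<le> m * x\<^sup>2 + k\<^sup>2 / (4 * m) * d\<^sup>2"
proof -
  have "0 \<le> m * (x - k / (2 * m) * d)\<^sup>2" using assms by simp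
  also have "\<dots> = m * x\<^sup>2 + k\<^sup>2 / (4 * m) * d\<^sup>2 - k * x * d"
    using assms by (simp add: field_simps power2_eq_square)
  finally show ?thesis by simp
qed

text \<open>Here time-scale separation enters. Young's inequality trades every product of the fast variable
  \<open>d\<close> with a slow one for a prescribed share of the slow square and a multiple of \<open>d\<^sup>2\<close>; these
  multiples are finite in number and independent of \<open>\<tau>a\<close>, so that \<open>2 / \<tau>a\<close> exceeds their sum
  when \<open>\<tau>a\<close> is small.\<close>

lemma fast_variable_absorbs_coupling:
  fixes m1 m2 m3 k1 k2 k3 k4 k5 :: real
  assumes "m1 > 0" "m2 > 0" "m3 > 0"
  obtains T where "T > 0" and "\<And>\<tau>a e z y d b. 0 < \<tau>a \<Longrightarrow> \<tau>a < T \<Longrightarrow>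
    d * (k1 * e + k2 * z + k3 * y + k4 * d + k5 * b) - 2 * d\<^sup>2 / \<tau>a
      \<le> m1 * e\<^sup>2 + m2 * z\<^sup>2 + m3 * y\<^sup>2 + b\<^sup>2 - d\<^sup>2"
proof -
  \<comment> \<open>The total price in \<open>d\<^sup>2\<close> of all couplings, plus one to leave the decay term \<open>- d\<^sup>2\<close>.\<close>
  define R where "R = k1\<^sup>2 / (4 * m1) + k2\<^sup>2 / (4 * m2) + k3\<^sup>2 / (4 * m3) + \<bar>k4\<bar> + k5\<^sup>2 / 4 + 1"
  have "R > 0" unfolding R_def using assms by (intro add_nonneg_pos add_nonneg_nonneg) auto
  show ?thesis
  proof (rule that[of "2 / R"])
    show "2 / R > 0" using \<open>R > 0\<close> by simp
    fix \<tau>a e z y d b :: real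
    assume "0 < \<tau>a" "\<tau>a < 2 / R"
    then have "R \<le> 2 / \<tau>a" using \<open>R > 0\<close> by (simp add: field_simps)
    then have "R * d\<^sup>2 \<le> 2 / \<tau>a * d\<^sup>2" by (rule mult_right_mono) simp
    moreover have "k4 * d\<^sup>2 \<le> \<bar>k4\<bar> * d\<^sup>2" by (rule mult_right_mono) auto
    ultimately show "d * (k1 * e + k2 * z + k3 * y + k4 * d + k5 * b) - 2 * d\<^sup>2 / \<tau>a
      \<le> m1 * e\<^sup>2 + m2 * z\<^sup>2 + m3 * y\<^sup>2 + b\<^sup>2 - d\<^sup>2"
      using young_ineq[OF assms(1), of k1 e d] young_ineq[OF assms(2), of k2 z d]
        young_ineq[OF assms(3), of k3 y d] young_ineq[of 1 k5 b d]
      by (simp add: R_def algebra_simps power2_eq_square)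
  qed
qed

text \<open>The terms in \<open>z\<close> and \<open>e\<close> are the oscillator energy \<open>\<beta> z\<^sup>2 + e\<^sup>2\<close> of \<open>z'' + \<alpha> z' + \<beta> z = 0\<close>
  plus \<open>\<alpha> z e + \<alpha>\<^sup>2 z\<^sup>2 / 2\<close>, written as a sum of squares. The plain energy dissipates only through
  \<open>e\<close>; the cross term \<open>\<alpha> z e\<close> adds dissipation in \<open>z\<close>, and the last term cancels the product
  \<open>z e\<close> that this creates. The rate becomes \<open>- \<alpha> e\<^sup>2 - \<alpha> \<beta> z\<^sup>2\<close>.\<close>

definition follower_energy :: "real \<Rightarrow> real \<Rightarrow> real \<Rightarrow> real \<Rightarrow> real \<Rightarrow> real \<Rightarrow> real \<Rightarrow> real" where
  "follower_energy \<alpha> \<beta> \<mu> z e y d =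
     \<beta> * z\<^sup>2 + (\<alpha> * z / 2)\<^sup>2 + (e + \<alpha> * z / 2)\<^sup>2 + \<mu> * y\<^sup>2 + d\<^sup>2"

lemma follower_energy_le:
  assumes "\<alpha> > 0" "\<beta> > 0" "\<mu> > 0" "m1 > 0" "m2 > 0" "m3 > 0"
  obtains c where "c > 0"
    and "\<And>z e y d. c * follower_energy \<alpha> \<beta> \<mu> z e y d \<le> m1 * e\<^sup>2 + m2 * z\<^sup>2 + m3 * y\<^sup>2 + d\<^sup>2"
proof -
  \<comment> \<open>The weight of \<open>z\<^sup>2\<close> after \<open>(e + \<alpha> z / 2)\<^sup>2 \<le> 2 e\<^sup>2 + 2 (\<alpha> z / 2)\<^sup>2\<close>.\<close>
  define A where "A = \<beta> + 3 * \<alpha>\<^sup>2 / 4"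
  have "A > 0" using assms by (simp add: A_def add_pos_nonneg)
  define c where "c = Min {m1 / 2, m2 / A, m3 / \<mu>, 1}"
  have "c > 0" using assms \<open>A > 0\<close> by (simp add: c_def)
  have "c \<le> m1 / 2" "c \<le> m2 / A" "c \<le> m3 / \<mu>" "c \<le> 1"
    unfolding c_def by (rule Min_le; simp)+
  then have c: "c * 2 \<le> m1" "c * A \<le> m2" "c * \<mu> \<le> m3" "c \<le> 1"
    using assms \<open>A > 0\<close> by (simp_all add: pos_le_divide_eq)
  show ?thesis
  proof (rule that[of c, OF \<open>c > 0\<close>])
    fix z e y d :: real
    have "0 \<le> (e - \<alpha> * z / 2)\<^sup>2" by simp
    then have "follower_energy \<alpha> \<beta> \<mu> z e y d \<le> 2 * e\<^sup>2 + A * z\<^sup>2 + \<mu> * y\<^sup>2 + d\<^sup>2"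
      by (simp add: follower_energy_def A_def field_simps power2_eq_square)
    then have "c * follower_energy \<alpha> \<beta> \<mu> z e y d \<le> c * (2 * e\<^sup>2 + A * z\<^sup>2 + \<mu> * y\<^sup>2 + d\<^sup>2)"
      using \<open>c > 0\<close> by simp
    also have "\<dots> = (c * 2) * e\<^sup>2 + (c * A) * z\<^sup>2 + (c * \<mu>) * y\<^sup>2 + c * d\<^sup>2"
      by (simp add: algebra_simps)
    also have "\<dots> \<le> m1 * e\<^sup>2 + m2 * z\<^sup>2 + m3 * y\<^sup>2 + 1 * d\<^sup>2"
      by (intro add_mono mult_right_mono c) auto
    finally show "c * follower_energy \<alpha> \<beta> \<mu> z e y d \<le> m1 * e\<^sup>2 + m2 * z\<^sup>2 + m3 * y\<^sup>2 + d\<^sup>2"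
      by simp
  qed
qed

lemma follower_energy_tendsto_0D:
  assumes "\<beta> > 0" "\<mu> > 0"
    and lim: "((\<lambda>t. follower_energy \<alpha> \<beta> \<mu> (z t) (e t) (y t) (d t)) \<longlongrightarrow> 0) F"
  shows "(z \<longlongrightarrow> 0) F" "(e \<longlongrightarrow> 0) F" "(y \<longlongrightarrow> 0) F" "(d \<longlongrightarrow> 0) F"
proof -
  let ?V = "\<lambda>t. follower_energy \<alpha> \<beta> \<mu> (z t) (e t) (y t) (d t)"
  have *: "(f \<longlongrightarrow> 0) F" if "k > 0" "\<And>t. k * (f t)\<^sup>2 \<le> ?V t" for f k
  proof -
    have "((\<lambda>t. ?V t / k) \<longlongrightarrow> 0) F" using tendsto_divide[OF lim tendsto_const[of k]] that by simp
    then have "((\<lambda>t. (f t)\<^sup>2) \<longlongrightarrow> 0) F"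
      by (rule tendsto_sandwich[OF _ _ tendsto_const, rotated 2])
        (use that in \<open>auto simp: field_simps\<close>)
    then show ?thesis by simp
  qed
  note simps = follower_energy_def
  show z: "(z \<longlongrightarrow> 0) F" by (rule *[of \<beta>]) (use assms in \<open>auto simp: simps\<close>)
  show "(y \<longlongrightarrow> 0) F" by (rule *[of \<mu>]) (use assms in \<open>auto simp: simps\<close>)
  show "(d \<longlongrightarrow> 0) F" by (rule *[of 1]) (use assms in \<open>auto simp: simps\<close>)
  have "((\<lambda>t. e t + \<alpha> * z t / 2) \<longlongrightarrow> 0) F"
    by (rule *[of 1]) (use assms in \<open>auto simp: simps\<close>)
  from tendsto_diff[OF this tendsto_mult[OF tendsto_const[of "\<alpha> / 2"] z]]
  show "(e \<longlongrightarrow> 0) F" by simp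
qed

text \<open>The left-hand side of the inequality is the derivative of the energy along the closed loop; primed
  variables stand for the time derivatives of the state, so the lemma is pure algebra. The weight
  \<open>\<mu>\<close> of the filter variable \<open>y\<close> is chosen so that its forcing by \<open>e\<close> costs exactly half of the
  decay \<open>- \<alpha> e\<^sup>2\<close> of the oscillator.\<close>

lemma follower_energy_dissipation:
  fixes \<tau> Kp Ki :: real
  assumes "\<tau> > 0" and "Kp > 0" and "Ki > 0"
  defines "\<alpha> \<equiv> \<tau> * Kp" and "\<beta> \<equiv> \<tau> * Ki" and "\<mu> \<equiv> \<tau> ^ 4 * Kp / 4"
  obtains T c K where "T > 0" and "c > 0"
    and "\<And>\<tau>a z e y d b e' y' d'. 0 < \<tau>a \<Longrightarrow> \<tau>a < T \<Longrightarrow>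
      e' = - \<alpha> * e - \<beta> * z - \<tau> * d \<Longrightarrow>
      y' = b - (y + e / \<tau>) / \<tau> \<Longrightarrow>
      d' = - d / \<tau>a - (Kp * e' + Ki * e + (y' + e' / \<tau>) / \<tau>) \<Longrightarrow>
      2 * \<beta> * z * e + \<alpha>\<^sup>2 * z * e / 2 + 2 * (e + \<alpha> * z / 2) * (e' + \<alpha> * e / 2)
        + 2 * \<mu> * y * y' + 2 * d * d'
      \<le> - c * follower_energy \<alpha> \<beta> \<mu> z e y d + K * b\<^sup>2"
proof -
  have pos: "\<alpha> > 0" "\<beta> > 0" "\<mu> > 0" using assms by auto
  \<comment> \<open>The coefficients \<open>k\<^sub>i\<close> collect every term with a factor \<open>d\<close> other than \<open>- 2 d\<^sup>2 / \<tau>a\<close>.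
    Writing \<open>q\<close> for \<open>1 / \<tau>\<close> turns the identity behind them into one between polynomials.\<close>
  define q where "q = 1 / \<tau>"
  define k1 where "k1 = - 2 * \<tau> - 2 * (Ki - Kp * \<alpha> - Kp * q - q ^ 3)"
  define k2 where "k2 = 2 * (Kp * \<beta> + Ki * q) - \<alpha> * \<tau>"
  define k3 where "k3 = 2 * q\<^sup>2"
  define k4 where "k4 = 2 * (Kp * \<tau> + q)"
  define k5 where "k5 = - 2 * q"
  \<comment> \<open>Half of the decay rates \<open>\<alpha> / 2\<close>, \<open>\<alpha> \<beta>\<close>, \<open>\<mu> / \<tau>\<close> of the slow variables: one half absorbs the
    coupling to \<open>d\<close>, the other half is what remains as dissipation.\<close>
  define m1 m2 m3 where m_def: "m1 = \<alpha> / 4" "m2 = \<alpha> * \<beta> / 2" "m3 = \<mu> / (2 * \<tau>)"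
  have m_pos: "m1 > 0" "m2 > 0" "m3 > 0" using pos \<open>\<tau> > 0\<close> by (auto simp: m_def)
  obtain T where "T > 0" and T: "\<And>\<tau>a e z y d b. 0 < \<tau>a \<Longrightarrow> \<tau>a < T \<Longrightarrow>
      d * (k1 * e + k2 * z + k3 * y + k4 * d + k5 * b) - 2 * d\<^sup>2 / \<tau>a
        \<le> m1 * e\<^sup>2 + m2 * z\<^sup>2 + m3 * y\<^sup>2 + b\<^sup>2 - d\<^sup>2"
    by (rule fast_variable_absorbs_coupling[OF m_pos, of k1 k2 k3 k4 k5]) (rule that)
  obtain c where "c > 0"
    and c: "\<And>z e y d. c * follower_energy \<alpha> \<beta> \<mu> z e y d \<le> m1 * e\<^sup>2 + m2 * z\<^sup>2 + m3 * y\<^sup>2 + d\<^sup>2"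
    by (rule follower_energy_le[OF pos m_pos]) (rule that)
  show ?thesis
  proof (rule that[of T c "2 * \<mu> * \<tau> + 1", OF \<open>T > 0\<close> \<open>c > 0\<close>])
    fix \<tau>a z e y d b e' y' d' :: real
    assume \<tau>a: "0 < \<tau>a" "\<tau>a < T"
      and e': "e' = - \<alpha> * e - \<beta> * z - \<tau> * d"
      and y': "y' = b - (y + e / \<tau>) / \<tau>"
      and d': "d' = - d / \<tau>a - (Kp * e' + Ki * e + (y' + e' / \<tau>) / \<tau>)"
    have slow: "2 * \<beta> * z * e + \<alpha>\<^sup>2 * z * e / 2 + 2 * (e + \<alpha> * z / 2) * (e' + \<alpha> * e / 2)
        = - \<alpha> * e\<^sup>2 - \<alpha> * \<beta> * z\<^sup>2 - 2 * \<tau> * e * d - \<alpha> * \<tau> * z * d"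
      unfolding e' by (simp add: field_simps power2_eq_square)
    have fast: "2 * d * d' - 2 * \<tau> * e * d - \<alpha> * \<tau> * z * d
        = d * (k1 * e + k2 * z + k3 * y + k4 * d + k5 * b) - 2 * d\<^sup>2 / \<tau>a"
    proof -
      have "e' / \<tau> = - Kp * e - Ki * z - d"
        using \<open>\<tau> > 0\<close> unfolding e' \<alpha>_def \<beta>_def by (simp add: field_simps)
      then have "(y' + e' / \<tau>) / \<tau> = (b - (y + e * q) * q - Kp * e - Ki * z - d) * q"
        unfolding y' q_def by simp
      then have "2 * d * d' = - 2 * d\<^sup>2 / \<tau>a - 2 * d * (Kp * e' + Ki * e
          + (b - (y + e * q) * q - Kp * e - Ki * z - d) * q)"
        unfolding d' by (simp add: right_diff_distrib power2_eq_square)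
      then show ?thesis
        unfolding e' k1_def k2_def k3_def k4_def k5_def
        by (simp add: algebra_simps power2_eq_square power3_eq_cube)
    qed
    have "2 * \<mu> * y * y' = 2 * \<mu> * (b * y) + 2 * \<mu> * (- 1 / \<tau>\<^sup>2 * e * y) - 2 * \<mu> / \<tau> * y\<^sup>2"
      using \<open>\<tau> > 0\<close> unfolding y' by (simp add: field_simps power2_eq_square)
    also have "\<dots> \<le> 2 * \<mu> * (\<tau> * b\<^sup>2 + 1 / (4 * \<tau>) * y\<^sup>2)
        + 2 * \<mu> * (1 / \<tau> ^ 3 * e\<^sup>2 + 1 / (4 * \<tau>) * y\<^sup>2) - 2 * \<mu> / \<tau> * y\<^sup>2"
    proof (intro diff_right_mono add_mono mult_left_mono)
      show "b * y \<le> \<tau> * b\<^sup>2 + 1 / (4 * \<tau>) * y\<^sup>2"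
        using young_ineq[OF \<open>\<tau> > 0\<close>, of 1 b y] by simp
      show "- 1 / \<tau>\<^sup>2 * e * y \<le> 1 / \<tau> ^ 3 * e\<^sup>2 + 1 / (4 * \<tau>) * y\<^sup>2"
        using young_ineq[of "1 / \<tau> ^ 3" "- 1 / \<tau>\<^sup>2" e y] \<open>\<tau> > 0\<close>
        by (simp add: power2_eq_square power3_eq_cube)
    qed (use pos in auto)
    also have "\<dots> = \<alpha> / 2 * e\<^sup>2 - \<mu> / \<tau> * y\<^sup>2 + 2 * \<mu> * \<tau> * b\<^sup>2"
      using \<open>\<tau> > 0\<close> by (simp add: \<mu>_def \<alpha>_def field_simps power2_eq_square power3_eq_cube power4_eq_xxxx)
    finally have gap: "2 * \<mu> * y * y' \<le> \<alpha> / 2 * e\<^sup>2 - \<mu> / \<tau> * y\<^sup>2 + 2 * \<mu> * \<tau> * b\<^sup>2" .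
    have m: "\<alpha> * e\<^sup>2 = 4 * (m1 * e\<^sup>2)" "\<alpha> / 2 * e\<^sup>2 = 2 * (m1 * e\<^sup>2)"
        "\<alpha> * \<beta> * z\<^sup>2 = 2 * (m2 * z\<^sup>2)" "\<mu> / \<tau> * y\<^sup>2 = 2 * (m3 * y\<^sup>2)"
      by (auto simp: m_def)
    show "2 * \<beta> * z * e + \<alpha>\<^sup>2 * z * e / 2 + 2 * (e + \<alpha> * z / 2) * (e' + \<alpha> * e / 2)
        + 2 * \<mu> * y * y' + 2 * d * d'
      \<le> - c * follower_energy \<alpha> \<beta> \<mu> z e y d + (2 * \<mu> * \<tau> + 1) * b\<^sup>2"
      using slow fast gap T[of \<tau>a d e z y b] \<tau>a c[of z e y d] m
      by (simp add: distrib_right)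
  qed
qed

section \<open>One follower\<close>

text \<open>Convergence of a vehicle whose predecessor has speed \<open>w\<close> and acceleration \<open>b\<close>. That the
  acceleration \<open>a\<close> vanishes in the limit is what allows the lemma to be applied to the next vehicle,
  and the threshold \<open>T\<close> is chosen before the trajectory, so that it can be shared by all vehicles.\<close>

lemma follower_converges:
  fixes \<tau> Kp Ki :: real
  assumes "\<tau> > 0" and "Kp > 0" and "Ki > 0"
  obtains T where "T > 0" and "\<And>\<tau>a \<eta> t0 w b s v a z. 0 < \<tau>a \<Longrightarrow> \<tau>a < T \<Longrightarrow>
    (\<And>t. t \<ge> t0 \<Longrightarrow> (w has_real_derivative b t) (at t within {t0..})) \<Longrightarrow>
    (\<And>t. t \<ge> t0 \<Longrightarrow> (s has_real_derivative w t - v t) (at t within {t0..})) \<Longrightarrow>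
    (\<And>t. t \<ge> t0 \<Longrightarrow> (v has_real_derivative a t) (at t within {t0..})) \<Longrightarrow>
    (\<And>t. t \<ge> t0 \<Longrightarrow> (a has_real_derivative - (1 / \<tau>a) *
        (a t - (Kp * (s t - \<eta> - \<tau> * v t) + Ki * z t + 1 / \<tau> * (w t - v t)))) (at t within {t0..})) \<Longrightarrow>
    (\<And>t. t \<ge> t0 \<Longrightarrow> (z has_real_derivative s t - \<eta> - \<tau> * v t) (at t within {t0..})) \<Longrightarrow>
    (b \<longlongrightarrow> 0) at_top \<Longrightarrow>
    ((\<lambda>t. s t - \<eta> - \<tau> * v t) \<longlongrightarrow> 0) at_top \<and> ((\<lambda>t. w t - v t) \<longlongrightarrow> 0) at_top \<and> (a \<longlongrightarrow> 0) at_top"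
proof -
  define \<alpha> \<beta> \<mu> where "\<alpha> = \<tau> * Kp" and "\<beta> = \<tau> * Ki" and "\<mu> = \<tau> ^ 4 * Kp / 4"
  have pos: "\<alpha> > 0" "\<beta> > 0" "\<mu> > 0" using assms by (auto simp: \<alpha>_def \<beta>_def \<mu>_def)
  obtain T c K where "T > 0" "c > 0" and dissip: "\<And>\<tau>a z e y d b e' y' d'. 0 < \<tau>a \<Longrightarrow> \<tau>a < T \<Longrightarrow>
      e' = - \<alpha> * e - \<beta> * z - \<tau> * d \<Longrightarrow>
      y' = b - (y + e / \<tau>) / \<tau> \<Longrightarrow>
      d' = - d / \<tau>a - (Kp * e' + Ki * e + (y' + e' / \<tau>) / \<tau>) \<Longrightarrow>
      2 * \<beta> * z * e + \<alpha>\<^sup>2 * z * e / 2 + 2 * (e + \<alpha> * z / 2) * (e' + \<alpha> * e / 2)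
        + 2 * \<mu> * y * y' + 2 * d * d'
      \<le> - c * follower_energy \<alpha> \<beta> \<mu> z e y d + K * b\<^sup>2"
  proof (rule follower_energy_dissipation[OF assms, folded \<alpha>_def \<beta>_def \<mu>_def], goal_cases)
    case (1 T c K)
    show ?case by (rule that[OF 1(2,3)]) (rule 1(4))
  qed
  show ?thesis
  proof (rule that[of T, OF \<open>T > 0\<close>], goal_cases)
    case D: (1 \<tau>a \<eta> t0 w b s v a z)
    define e where "e = (\<lambda>t. s t - \<eta> - \<tau> * v t)"
    define y where "y = (\<lambda>t. w t - v t - e t / \<tau>)"
    define d where "d = (\<lambda>t. a t - (Kp * e t + Ki * z t + (w t - v t) / \<tau>))"
    define e' where "e' = (\<lambda>t. - \<alpha> * e t - \<beta> * z t - \<tau> * d t)"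
    define y' where "y' = (\<lambda>t. b t - (y t + e t / \<tau>) / \<tau>)"
    define d' where "d' = (\<lambda>t. - d t / \<tau>a - (Kp * e' t + Ki * e t + (y' t + e' t / \<tau>) / \<tau>))"
    let ?V = "\<lambda>t. follower_energy \<alpha> \<beta> \<mu> (z t) (e t) (y t) (d t)"
    \<comment> \<open>The identity that needs \<open>Kd = 1 / \<tau>\<close>: the relative speed inside \<open>\<tau> u\<close> cancels the one in \<open>e'\<close>.\<close>
    have e'_eq: "e' t = w t - v t - \<tau> * a t" for t
      using \<open>\<tau> > 0\<close> by (simp add: e'_def d_def \<alpha>_def \<beta>_def field_simps)
    have y'_eq: "y' t + e' t / \<tau> = b t - a t" for t
      using \<open>\<tau> > 0\<close> unfolding e'_eq by (simp add: y'_def y_def field_simps)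
    have V_deriv: "(?V has_real_derivative
        2 * \<beta> * z t * e t + \<alpha>\<^sup>2 * z t * e t / 2 + 2 * (e t + \<alpha> * z t / 2) * (e' t + \<alpha> * e t / 2)
        + 2 * \<mu> * y t * y' t + 2 * d t * d' t) (at t within {t0..})" if "t \<ge> t0" for t
    proof -
      have w: "(w has_real_derivative b t) (at t within {t0..})"
       and s: "(s has_real_derivative w t - v t) (at t within {t0..})"
       and v: "(v has_real_derivative a t) (at t within {t0..})"
       and a: "(a has_real_derivative - (1 / \<tau>a) * d t) (at t within {t0..})"
       and z: "(z has_real_derivative e t) (at t within {t0..})"
        using D(3-7)[OF that] by (simp_all add: e_def d_def)
      have e: "(e has_real_derivative e' t) (at t within {t0..})"
        unfolding e_def
        by (rule DERIV_cong[OF DERIV_diff[OF DERIV_diff[OF s DERIV_const] DERIV_cmult[OF v]]])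
          (simp add: e'_eq)
      have y: "(y has_real_derivative y' t) (at t within {t0..})"
        unfolding y_def
        by (rule DERIV_cong[OF DERIV_diff[OF DERIV_diff[OF w v] DERIV_cdivide[OF e]]])
          (use y'_eq[of t] in linarith)
      have d: "(d has_real_derivative d' t) (at t within {t0..})"
        by (subst d_def, rule DERIV_cong[OF DERIV_diff[OF a DERIV_add[OF DERIV_add[OF
              DERIV_cmult[OF e] DERIV_cmult[OF z]] DERIV_cdivide[OF DERIV_diff[OF w v]]]]])
          (simp add: d'_def y'_eq)
      show ?thesis
        unfolding follower_energy_def
        by (auto intro!: derivative_eq_intros z e y d simp: field_simps power2_eq_square)
    qed
    have input: "((\<lambda>t. K * (b t)\<^sup>2) \<longlongrightarrow> 0) at_top"
      using tendsto_mult[OF tendsto_const[of K] tendsto_power[OF D(8), of 2]] by simp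
    have "(?V \<longlongrightarrow> 0) at_top"
    proof (rule dissipation_tendsto_0[OF V_deriv _ \<open>c > 0\<close> input])
      show "?V t \<ge> 0" for t using pos by (simp add: follower_energy_def)
    next
      fix t
      show "2 * \<beta> * z t * e t + \<alpha>\<^sup>2 * z t * e t / 2 + 2 * (e t + \<alpha> * z t / 2) * (e' t + \<alpha> * e t / 2)
        + 2 * \<mu> * y t * y' t + 2 * d t * d' t \<le> - c * ?V t + K * (b t)\<^sup>2"
        by (rule dissip[OF D(1,2)]) (simp_all add: e'_def y'_def d'_def)
    qed auto
    note lim = follower_energy_tendsto_0D[OF pos(2,3) this]
    \<comment> \<open>The relative speed \<open>w - v\<close> is \<open>y + e / \<tau>\<close>.\<close>
    have gap: "((\<lambda>t. y t + e t / \<tau>) \<longlongrightarrow> 0 + 0 / \<tau>) at_top"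
      using lim \<open>\<tau> > 0\<close> by (intro tendsto_intros) auto
    then have gap0: "((\<lambda>t. w t - v t) \<longlongrightarrow> 0) at_top" by (simp add: y_def)
    have err: "((\<lambda>t. s t - \<eta> - \<tau> * v t) \<longlongrightarrow> 0) at_top" using lim by (simp add: e_def)
    have "((\<lambda>t. d t + (Kp * e t + Ki * z t + (y t + e t / \<tau>) / \<tau>))
        \<longlongrightarrow> 0 + (Kp * 0 + Ki * 0 + (0 + 0 / \<tau>) / \<tau>)) at_top"
      using lim gap \<open>\<tau> > 0\<close> by (intro tendsto_intros) auto
    then have "(a \<longlongrightarrow> 0) at_top" by (simp add: d_def y_def)
    with gap0 err show ?case by blast
  qed
qed

section \<open>The platoon\<close>

theorem proposition1:
  fixes \<tau> Kp Ki Kd \<omega>n :: real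
  assumes "\<tau> > 0" and "Kp > 0" and "Ki > 0" and "Kd = 1 / \<tau>"
    and "\<omega>n > 0" and "\<omega>n\<^sup>2 = \<tau> * Ki"
  shows "\<exists>\<epsilon>0>0. \<forall>\<tau>a>0. \<forall>\<epsilon>. \<epsilon> = \<omega>n * \<tau>a \<and> \<epsilon> < \<epsilon>0 \<longrightarrow>
    (\<forall>N L \<eta> vstar t0 C p v a z.
       closed_loop_platoon Kp Ki Kd \<tau> \<tau>a \<eta> L N t0 p v a z \<and>
       (\<forall>t\<ge>t0. v 0 t = vstar) \<and>
       (\<forall>i\<in>followers N. \<forall>t\<ge>t0. \<bar>a i t - pid_command Kp Ki Kd \<tau> \<eta> L p v z i t\<bar> \<le> C * \<epsilon>) \<longrightarrow>
       (\<forall>i\<in>followers N.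
          (spacing_error \<tau> \<eta> L p v i \<longlongrightarrow> 0) at_top \<and>
          (rel_speed v i \<longlongrightarrow> 0) at_top \<and>
          ((\<lambda>t. (spacing L p i t, v i t)) \<longlongrightarrow> (\<eta> + \<tau> * vstar, vstar)) at_top) \<and>
       (\<forall>k1 k2. \<exists>S V. ovrv_ctg_equilibrium k1 k2 \<tau> \<eta> N vstar S V \<and>
          (\<forall>i\<in>followers N. ((\<lambda>t. (spacing L p i t, v i t)) \<longlongrightarrow> (S i, V i)) at_top)))"
proof -
  obtain T where "T > 0" and conv: "\<And>\<tau>a \<eta> t0 w b s v a z. 0 < \<tau>a \<Longrightarrow> \<tau>a < T \<Longrightarrow>
    (\<And>t. t \<ge> t0 \<Longrightarrow> (w has_real_derivative b t) (at t within {t0..})) \<Longrightarrow>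
    (\<And>t. t \<ge> t0 \<Longrightarrow> (s has_real_derivative w t - v t) (at t within {t0..})) \<Longrightarrow>
    (\<And>t. t \<ge> t0 \<Longrightarrow> (v has_real_derivative a t) (at t within {t0..})) \<Longrightarrow>
    (\<And>t. t \<ge> t0 \<Longrightarrow> (a has_real_derivative - (1 / \<tau>a) *
        (a t - (Kp * (s t - \<eta> - \<tau> * v t) + Ki * z t + 1 / \<tau> * (w t - v t)))) (at t within {t0..})) \<Longrightarrow>
    (\<And>t. t \<ge> t0 \<Longrightarrow> (z has_real_derivative s t - \<eta> - \<tau> * v t) (at t within {t0..})) \<Longrightarrow>
    (b \<longlongrightarrow> 0) at_top \<Longrightarrow>
    ((\<lambda>t. s t - \<eta> - \<tau> * v t) \<longlongrightarrow> 0) at_top \<and> ((\<lambda>t. w t - v t) \<longlongrightarrow> 0) at_top \<and> (a \<longlongrightarrow> 0) at_top"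
  proof (rule follower_converges[OF assms(1-3)], goal_cases)
    case (1 T)
    show ?case by (rule that[OF 1(2)]) (rule 1(3))
  qed
  show ?thesis
  proof (intro exI[of _ "\<omega>n * T"] conjI allI impI; (elim conjE)?)
    show "\<omega>n * T > 0" using \<open>T > 0\<close> \<open>\<omega>n > 0\<close> by simp
  next
    fix \<tau>a \<epsilon> N L \<eta> vstar t0 C and p v a z :: "nat \<Rightarrow> real \<Rightarrow> real"
    assume "\<tau>a > 0" and "\<epsilon> = \<omega>n * \<tau>a" and "\<epsilon> < \<omega>n * T"
      and loop: "closed_loop_platoon Kp Ki Kd \<tau> \<tau>a \<eta> L N t0 p v a z"
      and leader: "\<forall>t\<ge>t0. v 0 t = vstar"
    then have "\<tau>a < T" using \<open>\<omega>n > 0\<close> by simp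
    have step: "(spacing_error \<tau> \<eta> L p v i \<longlongrightarrow> 0) at_top \<and> (rel_speed v i \<longlongrightarrow> 0) at_top
        \<and> (a i \<longlongrightarrow> 0) at_top"
      if i: "i \<in> followers N" and b: "(b \<longlongrightarrow> 0) at_top"
        and pred: "\<And>t. t \<ge> t0 \<Longrightarrow> (v (i - 1) has_real_derivative b t) (at t within {t0..})" for i b
    proof -
      have "((\<lambda>t. spacing L p i t - \<eta> - \<tau> * v i t) \<longlongrightarrow> 0) at_top \<and>
          ((\<lambda>t. v (i - 1) t - v i t) \<longlongrightarrow> 0) at_top \<and> (a i \<longlongrightarrow> 0) at_top"
        by (rule conv[OF \<open>\<tau>a > 0\<close> \<open>\<tau>a < T\<close> _ _ _ _ _ b, where ?t0.0 = t0 and z = "z i"])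
          (use loop i pred assms(4) in
            \<open>auto simp: closed_loop_platoon_def pid_command_def spacing_error_def rel_speed_def\<close>)
      then show ?thesis
        by (simp add: spacing_error_def[abs_def] rel_speed_def[abs_def])
    qed
    \<comment> \<open>The claim \<open>a (Suc n) \<longlongrightarrow> 0\<close> is carried along as the input condition for the next vehicle.\<close>
    have all: "Suc n \<in> followers N \<Longrightarrow>
        (spacing_error \<tau> \<eta> L p v (Suc n) \<longlongrightarrow> 0) at_top \<and> (rel_speed v (Suc n) \<longlongrightarrow> 0) at_top
        \<and> (a (Suc n) \<longlongrightarrow> 0) at_top \<and> (v (Suc n) \<longlongrightarrow> vstar) at_top" for n
    proof (induction n)
      case 0
      have "(v 0 has_real_derivative 0) (at t within {t0..})" if "t \<ge> t0" for t
        by (rule has_field_derivative_transform_within[where f = "\<lambda>_. vstar" and d = 1])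
          (use leader that in auto)
      with step[OF 0, of "\<lambda>_. 0"] have *: "(spacing_error \<tau> \<eta> L p v (Suc 0) \<longlongrightarrow> 0) at_top \<and>
          (rel_speed v (Suc 0) \<longlongrightarrow> 0) at_top \<and> (a (Suc 0) \<longlongrightarrow> 0) at_top" by simp
      have "(v 0 \<longlongrightarrow> vstar) at_top"
        by (rule tendsto_eventually) (use leader in \<open>auto simp: eventually_at_top_linorder\<close>)
      from tendsto_diff[OF this conjunct1[OF conjunct2[OF *]]]
      have "(v (Suc 0) \<longlongrightarrow> vstar) at_top" by (simp add: rel_speed_def)
      with * show ?case by simp
    next
      case (Suc n)
      have n: "Suc n \<in> followers N"
        using Suc.prems by (auto simp: followers_def intro: order_trans[of _ "enat (Suc (Suc n))"])
      note IH = Suc.IH[OF n]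
      have "(v (Suc n) has_real_derivative a (Suc n) t) (at t within {t0..})" if "t \<ge> t0" for t
        using loop n that by (auto simp: closed_loop_platoon_def)
      with step[OF Suc.prems, of "a (Suc n)"] IH
      have *: "(spacing_error \<tau> \<eta> L p v (Suc (Suc n)) \<longlongrightarrow> 0) at_top \<and>
          (rel_speed v (Suc (Suc n)) \<longlongrightarrow> 0) at_top \<and> (a (Suc (Suc n)) \<longlongrightarrow> 0) at_top" by simp
      from IH have "(v (Suc n) \<longlongrightarrow> vstar) at_top" by simp
      from tendsto_diff[OF this conjunct1[OF conjunct2[OF *]]]
      have "(v (Suc (Suc n)) \<longlongrightarrow> vstar) at_top" by (simp add: rel_speed_def)
      with * show ?case by simp
    qed
    have lims: "(spacing_error \<tau> \<eta> L p v i \<longlongrightarrow> 0) at_top \<and> (rel_speed v i \<longlongrightarrow> 0) at_top \<and>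
        ((\<lambda>t. (spacing L p i t, v i t)) \<longlongrightarrow> (\<eta> + \<tau> * vstar, vstar)) at_top"
      if "i \<in> followers N" for i
    proof -
      obtain n where "i = Suc n" using \<open>i \<in> followers N\<close> by (cases i) (auto simp: followers_def)
      with all[of n] that have e: "(spacing_error \<tau> \<eta> L p v i \<longlongrightarrow> 0) at_top"
        and r: "(rel_speed v i \<longlongrightarrow> 0) at_top" and v: "(v i \<longlongrightarrow> vstar) at_top" by auto
      have "((\<lambda>t. spacing_error \<tau> \<eta> L p v i t + \<eta> + \<tau> * v i t) \<longlongrightarrow> 0 + \<eta> + \<tau> * vstar) at_top"
        by (intro tendsto_intros e v)
      then have "(spacing L p i \<longlongrightarrow> \<eta> + \<tau> * vstar) at_top"
        by (simp add: spacing_error_def)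
      with e r v show ?thesis by (auto intro: tendsto_Pair)
    qed
    show "\<forall>i\<in>followers N.
          (spacing_error \<tau> \<eta> L p v i \<longlongrightarrow> 0) at_top \<and>
          (rel_speed v i \<longlongrightarrow> 0) at_top \<and>
          ((\<lambda>t. (spacing L p i t, v i t)) \<longlongrightarrow> (\<eta> + \<tau> * vstar, vstar)) at_top"
      using lims by blast
    fix k1 k2
    show "\<exists>S V. ovrv_ctg_equilibrium k1 k2 \<tau> \<eta> N vstar S V \<and>
          (\<forall>i\<in>followers N. ((\<lambda>t. (spacing L p i t, v i t)) \<longlongrightarrow> (S i, V i)) at_top)"
      by (rule exI[of _ "\<lambda>_. \<eta> + \<tau> * vstar"], rule exI[of _ "\<lambda>_. vstar"])
        (use lims in \<open>auto simp: ovrv_ctg_equilibrium_def ovrv_acceleration_def\<close>)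
  qed
qed

end
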